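(* Let $A$ be an $n\times n$ real constant matrix with $\mathrm{Re}(\sigma(A))<0$. Consider the time-changed nonlinear system $$\mathrm{d}X(t)=AX(t)\,\mathrm{d}E_t+f(E_t,X(t))\,\mathrm{d}E_t,\qquad X(0)=x_0\in\mathbb{R}^n.$$ Suppose $f:\mathbb{R}^+\times\mathbb{R}^n\to\mathbb{R}^n$ is a nonlinear function which satisfies $$\|f(E_t,X(t))\|\le\|g(E_t)\|\,\|X(t)\|$$ with the function $g:\mathbb{R}^+\to\mathbb{R}^n$ satisfying $$\int_0^\infty\|g(s)\|\,\mathrm{d}s<\infty.$$ Then the trivial solution of the system is exponentially sample-path stable and, for $p\ge1$, $p$th moment asymptotically stable.
   Context: $U(t)$ is a $\beta$-stable subordinator, $\beta\in(0,1)$: a strictly increasing $\beta$-stable Lévy process with $\mathbb{E}[\exp(-sU(t))]=\exp(-ts^\beta)$. Its inverse is $E_t=\inf\{s>0:U(s)>t\}$, a continuous time-change. The differential equation is understood in integral form, with integrals with respect to $E_t$. $\sigma(A)$ is the spectrum of $A$, and $\mathrm{Re}(\sigma(A))<0$ means that every eigenvalue of $A$ has negative real part. $X(t)=X_t(x_0)$ denotes the solution with initial value $x_0$; it is assumed that the coefficients vanish at $x=0$ (so $f(E_t,0)=0$ for all $t\ge 0$), whence $X\equiv0$ is the solution for $x_0=0$, called the trivial solution. Definitions. The trivial solution is: (1) exponentially sample-path stable if there are a function $\nu:[0,\infty)\to[0,\infty)$ with $\nu(t)\to\infty$ as $t\to\infty$ and a pair of positive constants $\lambda$ and $K$ such that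 for every sample path $\|X(t)\|\le K\|x_0\|\exp(-\lambda\nu(t))$, where $t\ge0$ and $x_0\in\mathbb{R}^n$ is arbitrary; (2) $p$th moment asymptotically stable if there are a function $\nu:[0,\infty)\to[0,\infty)$ decaying to $0$ as $t\to\infty$ and a positive constant $K$ such that $\mathbb{E}\|X_t(x_0)\|^p\le K\|x_0\|^p\nu(t)$ for all $t\ge0$ and $x_0\in\mathbb{R}^n$.
   Formalization: In exponential sample-path stability the function ν may depend on the sample path (as with ν(t)=E_t), while λ and K may not; with one ν common to all paths the claim is false, e.g. for f=0, A=-I, since E_t≤1 has positive probability for every t. *)

theory Defs
  imports "HOL-Probability.Probability"
begin

definition matrix_spectrum :: "real ^ 'n ^ 'n \<Rightarrow> complex set" where
  "matrix_spectrum A =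
     {\<mu>. \<exists>v :: complex ^ 'n. v \<noteq> 0 \<and> (\<chi> i j. complex_of_real (A $ i $ j)) *v v = \<mu> *s v}"

text \<open>Processes are indexed by the nonnegative reals; the values at negative times are irrelevant.
  Stability is a statement about every sample path, so the path properties are required on every
  path rather than almost surely. Stochastic continuity follows from right-continuity.\<close>

definition levy_process :: "'a measure \<Rightarrow> (real \<Rightarrow> 'a \<Rightarrow> real) \<Rightarrow> bool" where
  "levy_process M U \<longleftrightarrow>
     (\<forall>t\<ge>0. U t \<in> borel_measurable M) \<and>
     (\<forall>\<omega>\<in>space M. U 0 \<omega> = 0) \<and>
     (\<forall>t :: nat \<Rightarrow> real. \<forall>n. 0 \<le> t 0 \<and> (\<forall>i<n. t i \<le> t (Suc i)) \<longrightarrow>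
        prob_space.indep_vars M (\<lambda>_. borel) (\<lambda>i \<omega>. U (t (Suc i)) \<omega> - U (t i) \<omega>) {..<n}) \<and>
     (\<forall>t\<ge>0. \<forall>h\<ge>0. distr M borel (\<lambda>\<omega>. U (t + h) \<omega> - U t \<omega>) = distr M borel (U h)) \<and>
     (\<forall>\<omega>\<in>space M. \<forall>t\<ge>0. ((\<lambda>s. U s \<omega>) \<longlongrightarrow> U t \<omega>) (at_right t)) \<and>
     (\<forall>\<omega>\<in>space M. \<forall>t>0. \<exists>l. ((\<lambda>s. U s \<omega>) \<longlongrightarrow> l) (at_left t))"

text \<open>The Laplace transform forces almost every path to be unbounded. As above this is required on
  every path, and it says that the infimum defining the inverse is never taken over the empty
  set, so that the inverse is a finite time-change.\<close>

definition stable_subordinator :: "'a measure \<Rightarrow> real \<Rightarrow> (real \<Rightarrow> 'a \<Rightarrow> real) \<Rightarrow> bool" where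
  "stable_subordinator M \<beta> U \<longleftrightarrow>
     levy_process M U \<and>
     (\<forall>\<omega>\<in>space M. strict_mono_on {0..} (\<lambda>t. U t \<omega>)) \<and>
     (\<forall>\<omega>\<in>space M. filterlim (\<lambda>t. U t \<omega>) at_top at_top) \<and>
     (\<forall>t\<ge>0. \<forall>s\<ge>0. prob_space.expectation M (\<lambda>\<omega>. exp (- s * U t \<omega>)) = exp (- t * s powr \<beta>))"

definition inverse_subordinator :: "(real \<Rightarrow> 'a \<Rightarrow> real) \<Rightarrow> real \<Rightarrow> 'a \<Rightarrow> real" where
  "inverse_subordinator U t \<omega> = Inf {s. s > 0 \<and> U s \<omega> > t}"

text \<open>Integrals with respect to \<open>E\<close> are pathwise Lebesgue--Stieltjes integrals. For the inverse of a
  subordinator \<open>E t \<omega>\<close> is \<open>0\<close> for \<open>t < 0\<close> and \<open>E\<close> is continuous and nondecreasing in \<open>t\<close>, so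
  \<open>interval_measure (\<lambda>s. E s \<omega>)\<close> is the intended atomless measure. Taking \<open>t = 0\<close> gives the
  initial condition.\<close>

definition time_changed_solution ::
  "'a measure \<Rightarrow> (real \<Rightarrow> 'a \<Rightarrow> real) \<Rightarrow> real ^ 'n ^ 'n \<Rightarrow> (real \<Rightarrow> real ^ 'n \<Rightarrow> real ^ 'n) \<Rightarrow>
   real ^ 'n \<Rightarrow> (real \<Rightarrow> 'a \<Rightarrow> real ^ 'n) \<Rightarrow> bool" where
  "time_changed_solution M E A f x0 X \<longleftrightarrow>
     (\<forall>t\<ge>0. X t \<in> borel_measurable M) \<and>
     (\<forall>\<omega>\<in>space M. \<forall>t\<ge>0.
        set_integrable (interval_measure (\<lambda>s. E s \<omega>)) {0<..t} (\<lambda>s. A *v X s \<omega>) \<and>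
        set_integrable (interval_measure (\<lambda>s. E s \<omega>)) {0<..t} (\<lambda>s. f (E s \<omega>) (X s \<omega>)) \<and>
        X t \<omega> = x0 + (LINT s:{0<..t}|interval_measure (\<lambda>s. E s \<omega>). A *v X s \<omega>)
                   + (LINT s:{0<..t}|interval_measure (\<lambda>s. E s \<omega>). f (E s \<omega>) (X s \<omega>)))"

text \<open>In the next two definitions \<open>X x0\<close> is the solution with initial value \<open>x0\<close>.

  The function \<open>\<nu>\<close> may depend on the sample path, while \<open>r\<close> and \<open>K\<close> may not. A function \<open>\<nu>\<close> common to all paths
  does not exist even for \<open>dX = - X dE\<close>, because \<open>E t \<le> 1\<close> has positive probability for every
  \<open>t\<close>.\<close>

definition exp_sample_path_stable ::
  "'a measure \<Rightarrow> (real ^ 'n \<Rightarrow> real \<Rightarrow> 'a \<Rightarrow> real ^ 'n) \<Rightarrow> bool" where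
  "exp_sample_path_stable M X \<longleftrightarrow>
     (\<exists>r>0. \<exists>K>0. \<forall>\<omega>\<in>space M. \<exists>\<nu> :: real \<Rightarrow> real.
        (\<forall>t\<ge>0. \<nu> t \<ge> 0) \<and> filterlim \<nu> at_top at_top \<and>
        (\<forall>t\<ge>0. \<forall>x0. norm (X x0 t \<omega>) \<le> K * norm x0 * exp (- r * \<nu> t)))"

text \<open>The expectation is a nonnegative integral, so the bound includes finiteness of the moment.\<close>

definition moment_asymp_stable ::
  "'a measure \<Rightarrow> real \<Rightarrow> (real ^ 'n \<Rightarrow> real \<Rightarrow> 'a \<Rightarrow> real ^ 'n) \<Rightarrow> bool" where
  "moment_asymp_stable M p X \<longleftrightarrow>
     (\<exists>\<nu> :: real \<Rightarrow> real. \<exists>K>0.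
        (\<forall>t\<ge>0. \<nu> t \<ge> 0) \<and> (\<nu> \<longlongrightarrow> 0) at_top \<and>
        (\<forall>t\<ge>0. \<forall>x0. (\<integral>\<^sup>+\<omega>. ennreal (norm (X x0 t \<omega>) powr p) \<partial>M)
                        \<le> ennreal (K * norm x0 powr p * \<nu> t)))"

end

theory Submission
  imports Defs "HOL-Computational_Algebra.Fundamental_Theorem_Algebra"
begin

text \<open>
  Run in the operational time \<open>s = E t\<close>, the time-changed equation is, path by path, the deterministic
  equation \<open>Y' = A Y + f(s, Y)\<close> with \<open>\<parallel>f(s, Y)\<parallel> \<le> \<parallel>g s\<parallel> \<parallel>Y\<parallel>\<close>. Its linear part decays exponentially and
  an integrable perturbation costs only the constant factor \<open>exp (k \<integral>\<parallel>g\<parallel>)\<close>, with \<open>k\<close> depending on \<open>A\<close> alone.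
  Hence \<open>\<parallel>X t\<parallel> \<le> K \<parallel>x0\<parallel> exp (- r E t)\<close> with \<open>K\<close> and \<open>r\<close> independent of the path. As \<open>E t\<close> tends to infinity on
  every path, this is exponential sample-path stability with \<open>\<nu> = E\<close>, and taking \<open>p\<close>th moments leaves
  the expectation of \<open>exp (- p r E t)\<close>, which tends to \<open>0\<close> by dominated convergence.

  The reduction to operational time rests on \<open>distr_u\<close>: the Stieltjes measure of \<open>E\<close> on \<open>(0, U T]\<close> is
  the image of Lebesgue measure on \<open>(0, T]\<close> under the path of the subordinator. Therefore
  \<open>Y s = X (U s)\<close> solves the deterministic equation, and \<open>X t = Y (E t)\<close> because \<open>X\<close> is constant wherever
  \<open>E\<close> is.

  The decay estimate does without matrix exponentials and variation of constants. The spectral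
  condition yields a norm \<open>N\<close> on the state space for which every short Euler step satisfies
  \<open>N (x + h A x) \<le> (1 - r h) N x\<close> (\<open>adapted_norm\<close>). It is a weighted sum of absolute values of linear
  functionals that triangularize the transpose of \<open>A\<close>, the weights decreasing so fast along the flag
  that the diagonal decay dominates the off-diagonal terms. In this norm a Gronwall argument
  on increments controls the perturbed equation (\<open>perturbed_linear_decay\<close>).
\<close>

section \<open>A norm contracted by a stable matrix\<close>

lemma linear_dependence_of_sequence:
  fixes v :: "nat \<Rightarrow> 'a::field ^ 'n"
  shows "\<exists>a. (\<exists>i\<le>CARD('n). a i \<noteq> 0) \<and> (\<Sum>i\<le>CARD('n). a i *s v i) = 0"
proof (cases "inj_on v {..CARD('n)}")
  case True
  let ?S = "v ` {..CARD('n)}"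
  have "card ?S = Suc CARD('n)" using True by (simp add: card_image)
  moreover have "vec.dim ?S \<le> CARD('n)" using vec.dim_subset[of ?S UNIV] by (simp only: vec_dim_card subset_UNIV)
  ultimately have "vec.dependent ?S" by (intro vec.dependent_biggerset_general) auto
  then obtain c where c: "\<exists>x\<in>?S. c x \<noteq> 0" "(\<Sum>x\<in>?S. c x *s x) = 0"
    by (subst (asm) vec.dependent_finite) auto
  then show ?thesis using True by (intro exI[of _ "c \<circ> v"]) (auto simp: sum.reindex)
next
  case False
  then obtain i j where ij: "i \<le> CARD('n)" "j \<le> CARD('n)" "i \<noteq> j" "v i = v j"
    by (auto simp: inj_on_def)
  let ?a = "\<lambda>k. (if k = i then 1 else 0) - (if k = j then 1 else 0) :: 'a"
  have "?a k *s v k = (if k = i then v i else 0) - (if k = j then v i else 0)" for k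
    using ij by (auto simp: vec.scale_left_diff_distrib)
  then have "(\<Sum>k\<le>CARD('n). ?a k *s v k) = 0" using ij by (simp add: sum_subtractf)
  then show ?thesis using ij by (intro exI[of _ ?a]) auto
qed

text \<open>For invariant \<open>W\<close> this is an eigenvector of the operator induced on the quotient by \<open>W\<close>. Among the
  nonzero polynomials \<open>p\<close> with \<open>p(B) u \<in> W\<close>, one of least degree has a root \<open>\<mu>\<close>, and for
  \<open>p = (X - \<mu>) q\<close> minimality puts \<open>w = q(B) u\<close> outside \<open>W\<close>.\<close>

lemma eigenvector_modulo_subspace:
  fixes B :: "complex ^ 'n ^ 'n"
  assumes W: "vec.subspace W" and u: "u \<notin> W"
  obtains w \<mu> where "w \<notin> W" "B *v w - \<mu> *s w \<in> W"
proof -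
  \<comment> \<open>the vector \<open>p(B) u\<close>\<close>
  define ev where "ev p = (\<Sum>i\<le>degree p. coeff p i *s (((*v) B ^^ i) u))" for p
  have ev: "ev p = (\<Sum>i\<le>m. coeff p i *s (((*v) B ^^ i) u))" if "degree p \<le> m" for p m
    unfolding ev_def using that by (intro sum.mono_neutral_left) (auto simp: coeff_eq_0)
  obtain a where a: "\<exists>i\<le>CARD('n). a i \<noteq> 0" "(\<Sum>i\<le>CARD('n). a i *s (((*v) B ^^ i) u)) = 0"
    using linear_dependence_of_sequence[of "\<lambda>i. ((*v) B ^^ i) u"] by blast
  define p0 where "p0 = (\<Sum>i\<le>CARD('n). monom (a i) i)"
  have cp0: "coeff p0 i = (if i \<le> CARD('n) then a i else 0)" for i
    by (simp add: p0_def coeff_sum)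
  have "degree p0 \<le> CARD('n)" by (rule degree_le) (simp add: cp0)
  then have "ev p0 = 0" using a(2) by (simp add: ev cp0)
  moreover have "p0 \<noteq> 0" using a(1) cp0 by (metis coeff_0)
  ultimately have ex: "p0 \<noteq> 0 \<and> ev p0 \<in> W" using vec.subspace_0[OF W] by simp
  define p where "p = arg_min degree (\<lambda>p. p \<noteq> 0 \<and> ev p \<in> W)"
  have p: "p \<noteq> 0" "ev p \<in> W" and least: "\<And>q. q \<noteq> 0 \<Longrightarrow> ev q \<in> W \<Longrightarrow> degree p \<le> degree q"
    using arg_min_nat_lemma[of "\<lambda>p. p \<noteq> 0 \<and> ev p \<in> W" p0 degree, OF ex] by (auto simp: p_def)
  have "degree p \<noteq> 0"
  proof
    assume d: "degree p = 0"
    then have c: "ev p = coeff p 0 *s u" "coeff p 0 \<noteq> 0"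
      using p(1) leading_coeff_0_iff[of p] by (auto simp: ev_def)
    then have "inverse (coeff p 0) *s ev p = u" by (simp add: vec.scale_scale)
    then show False using vec.subspace_scale[OF W p(2)] u by metis
  qed
  then obtain \<mu> where "poly p \<mu> = 0"
    using fundamental_theorem_of_algebra[of p] constant_degree[of p] by auto
  then obtain q where q: "p = [:- \<mu>, 1:] * q" by (auto simp: poly_eq_0_iff_dvd dvd_def)
  then have q0: "q \<noteq> 0" using p(1) by auto
  then have dp: "degree p = Suc (degree q)" unfolding q by (subst degree_mult_eq) auto
  then have "ev q \<notin> W" using least[OF q0] by auto
  moreover have "B *v ev q - \<mu> *s ev q \<in> W"
  proof -
    have "p = pCons 0 q - smult \<mu> q" unfolding q by (simp add: mult_pCons_left)
    then have "ev p = (\<Sum>i\<le>Suc (degree q). coeff (pCons 0 q) i *s (((*v) B ^^ i) u))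
        - \<mu> *s (\<Sum>i\<le>Suc (degree q). coeff q i *s (((*v) B ^^ i) u))"
      using dp by (simp only: ev_def coeff_diff coeff_smult vec.scale_left_diff_distrib
          sum_subtractf vec.scale_sum_right vec.scale_scale)
    also have "(\<Sum>i\<le>Suc (degree q). coeff q i *s (((*v) B ^^ i) u)) = ev q"
      by (rule ev[symmetric]) simp
    also have "(\<Sum>i\<le>Suc (degree q). coeff (pCons 0 q) i *s (((*v) B ^^ i) u)) = B *v ev q"
      by (subst sum.atMost_Suc_shift) (simp add: ev_def vec.linear_sum vec.linear_scale vec.scale vec.sum)
    finally show ?thesis using p(2) by simp
  qed
  ultimately show thesis by (rule that)
qed

lemma mat_mult_vector: "mat \<mu> *v x = \<mu> *s (x :: 'a::field ^ 'n)"
  by (simp add: vec_eq_iff matrix_vector_mult_def mat_def mult_delta_left)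

text \<open>Were \<open>B - \<mu>\<close> injective, it would map the finite-dimensional space \<open>W\<close> onto itself, and the value
  \<open>(B - \<mu>) w \<in> W\<close> would already be attained inside \<open>W\<close>.\<close>

lemma eigenvalue_of_subspace_extension:
  fixes B :: "complex ^ 'n ^ 'n"
  assumes W: "vec.subspace W" and inv: "\<And>w. w \<in> W \<Longrightarrow> B *v w \<in> W"
    and w: "w \<notin> W" "B *v w - \<mu> *s w \<in> W"
  shows "\<exists>v. v \<noteq> 0 \<and> B *v v = \<mu> *s v"
proof (rule ccontr)
  assume no: "\<not> ?thesis"
  define D where "D = B - mat \<mu>"
  have Dv: "D *v x = B *v x - \<mu> *s x" for x
    by (simp add: D_def matrix_vector_mult_diff_rdistrib mat_mult_vector)
  have inj: "inj ((*v) D)"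
    using no by (subst vec.inj_iff_eq_0) (auto simp: Dv)
  have "D *v x \<in> W" if "x \<in> W" for x
    unfolding Dv using that W inv by (intro vec.subspace_diff vec.subspace_scale) auto
  then have sub: "(*v) D ` W \<subseteq> W" by auto
  have "vec.dim ((*v) D ` W) = vec.dim W"
    using inj by (intro vec.dim_image_eq vec.linear_axioms) (auto simp: inj_on_def)
  then have "(*v) D ` W = W"
    using sub W by (intro vec.subspace_dim_equal) (auto intro: vec.subspace_image)
  then obtain z where z: "z \<in> W" "D *v z = D *v w" using w(2) Dv by (metis (no_types) imageE)
  then have "z = w" using inj by (auto simp: inj_on_def)
  then show False using z w by simp
qed

lemma eigenvalue_transpose:
  fixes C :: "'a::field ^ 'n ^ 'n"
  assumes "v \<noteq> 0" "transpose C *v v = \<mu> *s v"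
  shows "\<exists>x. x \<noteq> 0 \<and> C *v x = \<mu> *s x"
proof (rule ccontr)
  assume no: "\<not> ?thesis"
  have "\<forall>x. (C - mat \<mu>) *v x = 0 \<longrightarrow> x = 0"
    using no by (auto simp: matrix_vector_mult_diff_rdistrib mat_mult_vector)
  then have "invertible (C - mat \<mu>)"
    by (simp add: invertible_left_inverse matrix_left_invertible_ker)
  then have "invertible (transpose (C - mat \<mu>))" by (simp add: invertible_det_nz)
  moreover have "transpose (C - mat \<mu>) = transpose C - mat \<mu>"
    by (auto simp: transpose_def vec_eq_iff mat_def)
  ultimately have "\<forall>x. (transpose C - mat \<mu>) *v x = 0 \<longrightarrow> x = 0"
    by (simp add: invertible_left_inverse matrix_left_invertible_ker)
  then show False using assms by (auto simp: matrix_vector_mult_diff_rdistrib mat_mult_vector)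
qed

text \<open>The bilinear pairing, without complex conjugation: vectors \<open>w\<close> are used as linear functionals,
  and the adjoint of a matrix is then its transpose.\<close>

definition pairing :: "complex ^ 'n \<Rightarrow> complex ^ 'n \<Rightarrow> complex" where
  "pairing w x = (\<Sum>i\<in>UNIV. w $ i * x $ i)"

lemma pairing_simps:
  "pairing w (x + y) = pairing w x + pairing w y"
  "pairing (w + v) x = pairing w x + pairing v x"
  "pairing (c *s w) x = c * pairing w x"
  "pairing w (r *\<^sub>R x) = r * pairing w x"
  "pairing 0 x = 0"
  "pairing (axis i 1) x = x $ i"
  by (auto simp: pairing_def sum.distrib algebra_simps sum_distrib_left axis_def
      scaleR_conv_of_real[where 'a = complex] mult_delta_left mult_delta_right)

lemma pairing_transpose: "pairing w (C *v x) = pairing (transpose C *v w) x"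
  unfolding pairing_def matrix_vector_mult_def transpose_def
  by (simp add: sum_distrib_left sum_distrib_right mult_ac) (rule sum.swap)

lemma norm_pairing_le: "cmod (pairing w x) \<le> (\<Sum>i\<in>UNIV. cmod (w $ i)) * norm x"
  unfolding pairing_def sum_distrib_right
  by (intro order_trans[OF norm_sum] sum_mono) (auto simp: norm_mult intro!: mult_left_mono Finite_Cartesian_Product.norm_nth_le)

text \<open>The last clause says that the explicit Euler step of \<open>x' = C x\<close> contracts \<open>N\<close> at a linear rate; it is
  the logarithmic-norm formulation of \<open>N\<close> decaying exponentially along the flow. It avoids the
  matrix exponential, and it survives perturbations of the equation by the triangle inequality
  alone.\<close>

definition contracting_seminorm :: "complex ^ 'n ^ 'n \<Rightarrow> (complex ^ 'n \<Rightarrow> real) \<Rightarrow> bool" where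
  "contracting_seminorm C N \<longleftrightarrow>
     (\<forall>x y. N (x + y) \<le> N x + N y) \<and> (\<forall>x. 0 \<le> N x) \<and> (\<exists>c. \<forall>x. N x \<le> c * norm x) \<and>
     (\<exists>r>0. \<exists>\<delta>>0. \<forall>h x. 0 \<le> h \<longrightarrow> h \<le> \<delta> \<longrightarrow> N (x + h *\<^sub>R (C *v x)) \<le> (1 - r * h) * N x)"

lemma norm_one_plus_small:
  assumes "Re \<mu> < 0"
  obtains a \<delta> where "0 < a" "0 < \<delta>" "\<And>h. 0 \<le> h \<Longrightarrow> h \<le> \<delta> \<Longrightarrow> cmod (1 + of_real h * \<mu>) \<le> 1 - a * h"
proof -
  \<comment> \<open>The square of the left side is \<open>1 + 2 h Re \<mu> + h\<^sup>2 |\<mu>|\<^sup>2\<close>; half of the decay \<open>- Re \<mu>\<close> is given up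
    to absorb the quadratic term.\<close>
  define a where "a = - Re \<mu> / 2"
  have a: "0 < a" using assms by (simp add: a_def)
  have n: "0 < (cmod \<mu>)\<^sup>2" using assms by auto
  define \<delta> where "\<delta> = min (1 / a) (2 * a / (cmod \<mu>)\<^sup>2)"
  have d: "0 < \<delta>" using a n by (simp add: \<delta>_def)
  have "cmod (1 + of_real h * \<mu>) \<le> 1 - a * h" if h: "0 \<le> h" "h \<le> \<delta>" for h
  proof (rule power2_le_imp_le)
    have "h \<le> 1 / a" using h by (simp add: \<delta>_def)
    then show "0 \<le> 1 - a * h" using a by (simp add: field_simps)
    have "h \<le> 2 * a / (cmod \<mu>)\<^sup>2" using h by (simp add: \<delta>_def)
    then have "h * (cmod \<mu>)\<^sup>2 \<le> 2 * a" using n by (simp add: field_simps)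
    then have le: "h * (h * (cmod \<mu>)\<^sup>2) \<le> 2 * (a * h)"
      using h mult_left_mono[of "h * (cmod \<mu>)\<^sup>2" "2 * a" h] by (simp add: mult_ac)
    have "(cmod (1 + of_real h * \<mu>))\<^sup>2 = 1 - 4 * (a * h) + h * (h * (cmod \<mu>)\<^sup>2)"
      unfolding cmod_power2 a_def by (simp add: power2_eq_square algebra_simps)
    also have "\<dots> \<le> 1 - 2 * (a * h) + (a * h)\<^sup>2"
      using le zero_le_power2[of "a * h"] by linarith
    also have "\<dots> = (1 - a * h)\<^sup>2" by (simp add: power2_eq_square algebra_simps)
    finally show "(cmod (1 + of_real h * \<mu>))\<^sup>2 \<le> (1 - a * h)\<^sup>2" .
  qed
  then show thesis using that a d by blast
qed

text \<open>The functional \<open>w\<close> evolves by \<open>(w x)' = \<mu> (w x) + z x\<close>, so \<open>|w x|\<close> decays up to a forcing term of size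
  \<open>c N x\<close>. If \<open>|w x|\<close> is added with a weight \<open>\<epsilon>\<close> so small that \<open>\<epsilon> c\<close> is half the decay rate \<open>r\<close> of
  \<open>N\<close>, the old seminorm pays for the forcing and still decays at rate \<open>r / 2\<close>.\<close>

lemma contracting_seminorm_extend:
  fixes C :: "complex ^ 'n ^ 'n"
  assumes N: "contracting_seminorm C N" and "Re \<mu> < 0"
    and z: "z = transpose C *v w - \<mu> *s w" "\<And>x. cmod (pairing z x) \<le> c * N x"
  obtains \<epsilon> where "0 < \<epsilon>" "contracting_seminorm C (\<lambda>x. \<epsilon> * cmod (pairing w x) + N x)"
proof -
  obtain b r \<delta> where N1: "\<And>x y. N (x + y) \<le> N x + N y" and N2: "\<And>x. 0 \<le> N x"
    and N3: "\<And>x. N x \<le> b * norm x" and r: "0 < r" "0 < \<delta>"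
    and N4: "\<And>h x. 0 \<le> h \<Longrightarrow> h \<le> \<delta> \<Longrightarrow> N (x + h *\<^sub>R (C *v x)) \<le> (1 - r * h) * N x"
    using N unfolding contracting_seminorm_def by metis
  obtain a \<eta> where a: "0 < a" "0 < \<eta>" "\<And>h. 0 \<le> h \<Longrightarrow> h \<le> \<eta> \<Longrightarrow> cmod (1 + of_real h * \<mu>) \<le> 1 - a * h"
    using norm_one_plus_small[OF \<open>Re \<mu> < 0\<close>] by blast
  define c' where "c' = max c 1"
  have c': "0 < c'" "\<And>x. cmod (pairing z x) \<le> c' * N x"
    using z(2) mult_right_mono[OF _ N2, of c c'] by (auto simp: c'_def intro: order_trans)
  define \<epsilon> where "\<epsilon> = r / (2 * c')"
  have e: "0 < \<epsilon>" "\<epsilon> * c' = r / 2" using r c' by (auto simp: \<epsilon>_def)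
  let ?N = "\<lambda>x. \<epsilon> * cmod (pairing w x) + N x"
  have 1: "?N (x + y) \<le> ?N x + ?N y" for x y
    using N1[of x y] mult_left_mono[OF norm_triangle_ineq[of "pairing w x" "pairing w y"], of \<epsilon>] e
    by (simp add: pairing_simps algebra_simps)
  have 2: "0 \<le> ?N x" for x using N2[of x] e by simp
  have 3: "?N x \<le> (\<epsilon> * (\<Sum>i\<in>UNIV. cmod (w $ i)) + b) * norm x" for x
    using N3[of x] mult_left_mono[OF norm_pairing_le[of w x], of \<epsilon>] e(1)
    unfolding distrib_right mult.assoc by linarith
  have 4: "?N (x + h *\<^sub>R (C *v x)) \<le> (1 - min a (r / 2) * h) * ?N x"
    if h: "0 \<le> h" "h \<le> min \<delta> \<eta>" for h x
  proof -
    have "pairing w (x + h *\<^sub>R (C *v x)) = pairing w x + h * pairing (transpose C *v w) x"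
      by (simp add: pairing_simps pairing_transpose)
    also have "transpose C *v w = \<mu> *s w + z" by (simp add: z)
    also have "pairing w x + h * pairing (\<mu> *s w + z) x = (1 + h * \<mu>) * pairing w x + h * pairing z x"
      by (simp add: pairing_simps algebra_simps)
    finally have "cmod (pairing w (x + h *\<^sub>R (C *v x)))
        \<le> cmod (1 + h * \<mu>) * cmod (pairing w x) + h * cmod (pairing z x)"
      using norm_triangle_ineq[of "(1 + h * \<mu>) * pairing w x" "h * pairing z x"] h by (simp add: norm_mult)
    also have "\<dots> \<le> (1 - a * h) * cmod (pairing w x) + h * (c' * N x)"
      using a(3)[of h] h c' by (intro add_mono mult_right_mono mult_left_mono) auto
    finally have "\<epsilon> * cmod (pairing w (x + h *\<^sub>R (C *v x)))
        \<le> \<epsilon> * ((1 - a * h) * cmod (pairing w x) + h * (c' * N x))"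
      using e by (intro mult_left_mono) auto
    also have "\<dots> = (1 - a * h) * (\<epsilon> * cmod (pairing w x)) + h * (\<epsilon> * c') * N x"
      by (simp add: algebra_simps)
    also have "\<dots> = (1 - a * h) * (\<epsilon> * cmod (pairing w x)) + h * (r / 2) * N x"
      using e(2) by simp
    finally have "?N (x + h *\<^sub>R (C *v x))
        \<le> (1 - a * h) * (\<epsilon> * cmod (pairing w x)) + h * (r / 2) * N x + (1 - r * h) * N x"
      using N4[of h x] h by simp
    also have "\<dots> = (1 - a * h) * (\<epsilon> * cmod (pairing w x)) + (1 - (r / 2) * h) * N x"
      by (simp add: algebra_simps)
    also have "\<dots> \<le> (1 - min a (r / 2) * h) * (\<epsilon> * cmod (pairing w x)) + (1 - min a (r / 2) * h) * N x"
      using N2[of x] e h by (intro add_mono mult_right_mono diff_left_mono) auto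
    finally show ?thesis by (simp add: algebra_simps)
  qed
  have "\<exists>r>0. \<exists>\<delta>>0. \<forall>h x. 0 \<le> h \<longrightarrow> h \<le> \<delta> \<longrightarrow> ?N (x + h *\<^sub>R (C *v x)) \<le> (1 - r * h) * ?N x"
    using 4 r a by (intro exI[of _ "min a (r / 2)"] exI[of _ "min \<delta> \<eta>"] conjI allI impI) auto
  then have "contracting_seminorm C ?N" unfolding contracting_seminorm_def using 1 2 3 by blast
  then show thesis using that e by blast
qed

text \<open>Triangularization of the transpose in disguise: the functionals controlled by \<open>N\<close> form an
  invariant subspace, which grows by one dimension at a time. Each new functional is an
  eigenvector modulo the previous ones, and its eigenvalue is one of \<open>C\<close>, hence has negative real
  part.\<close>

lemma contracting_seminorm_flag:
  fixes C :: "complex ^ 'n ^ 'n"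
  assumes neg: "\<forall>\<mu> v. v \<noteq> 0 \<and> C *v v = \<mu> *s v \<longrightarrow> Re \<mu> < 0"
  shows "k \<le> CARD('n) \<Longrightarrow> \<exists>W N. vec.subspace W \<and> vec.dim W = k \<and> (\<forall>w\<in>W. transpose C *v w \<in> W) \<and>
      contracting_seminorm C N \<and> (\<forall>w\<in>W. \<exists>c. \<forall>x. cmod (pairing w x) \<le> c * N x)"
proof (induction k)
  case 0
  have "contracting_seminorm C (\<lambda>_. 0)" unfolding contracting_seminorm_def
    by (intro conjI exI[of _ 1]) auto
  then show ?case
    by (intro exI[of _ "{0}"] exI[of _ "\<lambda>_. 0"]) (auto simp: pairing_simps vec.subspace_def)
next
  case (Suc k)
  then obtain W N where W: "vec.subspace W" "vec.dim W = k" and inv: "\<And>w. w \<in> W \<Longrightarrow> transpose C *v w \<in> W"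
    and N: "contracting_seminorm C N" and dom: "\<And>w. w \<in> W \<Longrightarrow> \<exists>c. \<forall>x. cmod (pairing w x) \<le> c * N x"
    by (meson Suc_leD)
  have "W \<noteq> UNIV" using W(2) Suc.prems vec_dim_card[where 'a = complex and 'n = 'n] by auto
  then obtain u where u: "u \<notin> W" by auto
  obtain w \<mu> where w: "w \<notin> W" "transpose C *v w - \<mu> *s w \<in> W"
    using eigenvector_modulo_subspace[OF W(1) u] by blast
  obtain v where v: "v \<noteq> 0" "transpose C *v v = \<mu> *s v"
    using eigenvalue_of_subspace_extension[OF W(1) inv w] by blast
  have \<mu>: "Re \<mu> < 0" using eigenvalue_transpose[OF v] neg by blast
  obtain c where c: "\<And>x. cmod (pairing (transpose C *v w - \<mu> *s w) x) \<le> c * N x"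
    using dom[OF w(2)] by blast
  obtain \<epsilon> where e: "0 < \<epsilon>" "contracting_seminorm C (\<lambda>x. \<epsilon> * cmod (pairing w x) + N x)"
    using contracting_seminorm_extend[OF N \<mu> refl c] by blast
  let ?W = "vec.span (insert w W)"
  have spanW: "vec.span W = W" using W(1) by (simp add: vec.span_eq_iff)
  have split: "\<exists>k. y - k *s w \<in> W" if "y \<in> ?W" for y
    using that by (simp add: vec.span_breakdown_eq spanW)
  have N2: "0 \<le> N x" for x using N by (auto simp: contracting_seminorm_def)
  have "\<exists>c. \<forall>x. cmod (pairing y x) \<le> c * (\<epsilon> * cmod (pairing w x) + N x)" if y: "y \<in> ?W" for y
  proof -
    obtain k where k: "y - k *s w \<in> W" using split[OF y] by blast
    obtain c where c: "\<And>x. cmod (pairing (y - k *s w) x) \<le> c * N x" using dom[OF k] by blast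
    have "cmod (pairing y x) \<le> (cmod k / \<epsilon> + \<bar>c\<bar>) * (\<epsilon> * cmod (pairing w x) + N x)" for x
    proof -
      have "pairing y x = k * pairing w x + pairing (y - k *s w) x"
        using pairing_simps(2)[of "k *s w" "y - k *s w" x] by (simp add: pairing_simps)
      then have "cmod (pairing y x) \<le> cmod k * cmod (pairing w x) + c * N x"
        using norm_triangle_ineq[of "k * pairing w x" "pairing (y - k *s w) x"] c[of x]
        by (simp add: norm_mult)
      also have "\<dots> \<le> cmod k * cmod (pairing w x) + \<bar>c\<bar> * N x"
        using mult_right_mono[OF abs_ge_self N2, of c x] by simp
      also have "\<dots> \<le> cmod k * cmod (pairing w x) + \<bar>c\<bar> * N x
          + (cmod k / \<epsilon> * N x + \<bar>c\<bar> * (\<epsilon> * cmod (pairing w x)))"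
        using e N2[of x] by simp
      also have "\<dots> = (cmod k / \<epsilon> + \<bar>c\<bar>) * (\<epsilon> * cmod (pairing w x) + N x)"
        using e by (simp add: algebra_simps)
      finally show ?thesis .
    qed
    then show ?thesis by blast
  qed
  moreover have "transpose C *v y \<in> ?W" if y: "y \<in> ?W" for y
  proof -
    obtain k where k: "y - k *s w \<in> W" using split[OF y] by blast
    have "transpose C *v y = transpose C *v (y - k *s w) + k *s ((transpose C *v w - \<mu> *s w) + \<mu> *s w)"
      by (simp add: vec.diff vec.scale)
    also have "\<dots> \<in> ?W"
      using inv[OF k] w(2) by (intro vec.span_add vec.span_scale) (auto intro: vec.span_base)
    finally show ?thesis .
  qed
  moreover have "vec.dim ?W = Suc k" using W(2) w(1) by (simp add: vec.dim_insert spanW)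
  ultimately show ?case using e(2) by (intro exI[of _ ?W] exI[of _ "\<lambda>x. \<epsilon> * cmod (pairing w x) + N x"]) auto
qed

text \<open>Once every functional is controlled, in particular every coordinate, the seminorm is equivalent
  to the Euclidean norm. Restricting it to real vectors gives a Lyapunov function for \<open>x' = A x\<close>.\<close>

lemma adapted_norm:
  fixes A :: "real ^ 'n ^ 'n"
  assumes "\<forall>\<mu>\<in>matrix_spectrum A. Re \<mu> < 0"
  obtains N b c r \<delta> where "\<And>x y. N (x + y) \<le> N x + N y" "\<And>x. 0 \<le> N x"
    "0 < b" "\<And>x. N x \<le> b * norm x" "0 < c" "\<And>x. norm x \<le> c * N x"
    "0 < r" "0 < \<delta>" "\<And>h x. 0 \<le> h \<Longrightarrow> h \<le> \<delta> \<Longrightarrow> N (x + h *\<^sub>R (A *v x)) \<le> (1 - r * h) * N x"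
proof -
  define C :: "complex ^ 'n ^ 'n" where "C = (\<chi> i j. complex_of_real (A $ i $ j))"
  \<comment> \<open>complexification of real vectors, an isometry that intertwines \<open>A\<close> and \<open>C\<close>\<close>
  define J :: "real ^ 'n \<Rightarrow> complex ^ 'n" where "J x = (\<chi> i. complex_of_real (x $ i))" for x
  have JA: "J (A *v x) = C *v J x" for x
    by (simp add: J_def C_def matrix_vector_mult_def vec_eq_iff)
  have J: "J (x + y) = J x + J y" "J (h *\<^sub>R x) = h *\<^sub>R J x" "norm (J x) = norm x" for x y h
    by (auto simp: J_def vec_eq_iff norm_vec_def scaleR_conv_of_real[where 'a = complex])
  have eig: "\<forall>\<mu> v. v \<noteq> 0 \<and> C *v v = \<mu> *s v \<longrightarrow> Re \<mu> < 0"
    using assms by (auto simp: matrix_spectrum_def C_def)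
  obtain W N where W: "vec.subspace W" "vec.dim W = CARD('n)" "contracting_seminorm C N"
     "\<forall>w\<in>W. \<exists>c. \<forall>x. cmod (pairing w x) \<le> c * N x"
    using contracting_seminorm_flag[OF eig order_refl] by blast
  have "W = UNIV" using W(1,2) vec_dim_card[where 'a = complex and 'n = 'n]
    by (intro vec.subspace_dim_equal) auto
  then have "\<exists>c. \<forall>x. cmod (pairing (axis i 1) x) \<le> c * N x" for i using W(4) by blast
  then obtain c where c: "\<And>i x. cmod (x $ i) \<le> c i * N x" unfolding pairing_simps by metis
  obtain b r \<delta> where N1: "\<And>x y. N (x + y) \<le> N x + N y" and N2: "\<And>x. 0 \<le> N x"
    and N3: "\<And>x. N x \<le> b * norm x" and r: "0 < r" "0 < \<delta>"
    and N4: "\<And>h x. 0 \<le> h \<Longrightarrow> h \<le> \<delta> \<Longrightarrow> N (x + h *\<^sub>R (C *v x)) \<le> (1 - r * h) * N x"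
    using W(3) unfolding contracting_seminorm_def by metis
  let ?c = "max 1 (\<Sum>i\<in>UNIV. c i)"
  show thesis
  proof (rule that[of "\<lambda>x. N (J x)" "max 1 b" ?c r \<delta>])
    fix x :: "real ^ 'n"
    show "N (J x) \<le> max 1 b * norm x"
      using N3[of "J x"] mult_right_mono[OF max.cobounded2[of b 1], of "norm x"] J(3) by simp
    have "norm x = norm (J x)" by (simp add: J)
    also have "\<dots> \<le> (\<Sum>i\<in>UNIV. cmod (J x $ i))" by (simp add: norm_vec_def L2_set_le_sum)
    also have "\<dots> \<le> (\<Sum>i\<in>UNIV. c i * N (J x))" by (intro sum_mono c)
    also have "\<dots> = (\<Sum>i\<in>UNIV. c i) * N (J x)" by (simp add: sum_distrib_right)
    also have "\<dots> \<le> ?c * N (J x)" by (intro mult_right_mono N2) simp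
    finally show "norm x \<le> ?c * N (J x)" .
  qed (use N1 N2 N4 r in \<open>auto simp: J JA\<close>)
qed

section \<open>Decay under an integrable perturbation\<close>

text \<open>For \<open>N\<close> as provided by \<open>adapted_norm\<close> and \<open>G t = integral {0..t} \<gamma>\<close>, the function
  \<open>\<phi> t = N (Y t) * exp (r * t - b * c * G t)\<close> does not increase. As \<open>F\<close> is merely integrable, \<open>Y\<close> need not be
  differentiable everywhere, so increments take the place of derivatives: over a short interval
  of length \<open>h\<close> the equation is an Euler step for \<open>A\<close> plus an error, whence
  \<open>N (Y t) \<le> N (Y s) * (1 - r * h + b * c * (G t - G s))\<close> up to \<open>b * \<eta>\<close> times the increment of the
  increasing function \<open>m t = \<alpha> * t + G t\<close>, where \<open>\<alpha>\<close> bounds \<open>A\<close> and \<open>\<eta>\<close> the oscillation of \<open>Y\<close>. For \<open>\<phi>\<close> such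
  errors add up along a subdivision to at most a constant times \<open>\<eta>\<close>, and \<open>\<eta>\<close> is arbitrary.\<close>

lemma perturbed_linear_decay:
  fixes A :: "real ^ 'n ^ 'n" and Y F :: "real \<Rightarrow> real ^ 'n"
  assumes N_add: "\<And>x y. N (x + y) \<le> N x + N y" and N_nonneg: "\<And>x. 0 \<le> N x"
    and b: "0 < b" "\<And>x. N x \<le> b * norm x" and c: "0 < c" "\<And>x. norm x \<le> c * N x"
    and r: "0 < r" "0 < \<delta>"
    and contract: "\<And>h x. 0 \<le> h \<Longrightarrow> h \<le> \<delta> \<Longrightarrow> N (x + h *\<^sub>R (A *v x)) \<le> (1 - r * h) * N x"
    and T: "0 \<le> T"
    and int_AY: "(\<lambda>s. A *v Y s) integrable_on {0..T}" and int_F: "F integrable_on {0..T}"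
    and int_g: "\<gamma> integrable_on {0..T}" and g_nonneg: "\<And>s. 0 \<le> \<gamma> s"
    and F_le: "\<And>s. 0 \<le> s \<Longrightarrow> s \<le> T \<Longrightarrow> norm (F s) \<le> \<gamma> s * norm (Y s)"
    and Y: "\<And>t. 0 \<le> t \<Longrightarrow> t \<le> T \<Longrightarrow>
              Y t = x0 + integral {0..t} (\<lambda>s. A *v Y s) + integral {0..t} F"
  shows "N (Y T) \<le> N x0 * exp (b * c * integral {0..T} \<gamma> - r * T)"
proof -
  define G where "G t = integral {0..t} \<gamma>" for t
  define \<phi> where "\<phi> t = N (Y t) * exp (r * t - b * c * G t)" for t
  obtain \<alpha> where \<alpha>: "0 < \<alpha>" "\<And>x. norm (A *v x) \<le> norm x * \<alpha>"
    using bounded_linear.pos_bounded[OF matrix_vector_mul_bounded_linear[of A]] by blast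
  define m where "m t = \<alpha> * t + G t" for t
  have sub: "f integrable_on {s..t}" if "f integrable_on {0..T}" "0 \<le> s" "t \<le> T"
    for f :: "real \<Rightarrow> 'b::banach" and s t
    using that by (intro integrable_on_subinterval[OF that(1)]) auto
  have diff: "integral {s..t} f = integral {0..t} f - integral {0..s} f"
    if "f integrable_on {0..T}" "0 \<le> s" "s \<le> t" "t \<le> T" for f :: "real \<Rightarrow> 'b::banach" and s t
    using Henstock_Kurzweil_Integration.integral_combine[OF that(2,3) sub[OF that(1) order_refl that(4)]]
    by (simp add: algebra_simps)
  have G_mono: "0 \<le> G t - G s" if "0 \<le> s" "s \<le> t" "t \<le> T" for s t
    using diff[OF int_g that] integral_nonneg[OF sub[OF int_g, of s t]] g_nonneg that by (simp add: G_def)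
  have G0: "G 0 = 0" by (simp add: G_def)
  have "continuous_on {0..T} (\<lambda>t. x0 + integral {0..t} (\<lambda>s. A *v Y s) + integral {0..t} F)"
    by (intro continuous_intros indefinite_integral_continuous_1 int_AY int_F)
  then have "continuous_on {0..T} Y"
    by (rule continuous_on_cong[THEN iffD1, rotated 2]) (use Y in auto)
  then have uc: "uniformly_continuous_on {0..T} Y"
    by (intro compact_uniformly_continuous) auto
  define K where "K = b * exp (r * T)"
  have step: "\<phi> T - \<phi> 0 \<le> \<eta> * K * (m T - m 0)" if \<eta>: "0 < \<eta>" for \<eta>
  proof -
    obtain \<delta>' where \<delta>': "0 < \<delta>'"
      "\<And>s t. s \<in> {0..T} \<Longrightarrow> t \<in> {0..T} \<Longrightarrow> dist s t < \<delta>' \<Longrightarrow> dist (Y s) (Y t) < \<eta>"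
      using uc \<eta> unfolding uniformly_continuous_on_def by metis
    have local_bound: "\<phi> t - \<phi> s \<le> \<eta> * K * (m t - m s)"
      if st: "0 \<le> s" "s \<le> t" "t \<le> T" "t - s < min \<delta> \<delta>'" for s t
    proof -
      let ?h = "t - s" and ?n = "N (Y s)" and ?g = "G t - G s"
      have near: "norm (Y w - Y s) \<le> \<eta>" if "w \<in> {s..t}" for w
        using \<delta>'(2)[of w s] that st by (auto simp: dist_norm)
      let ?I = "integral {s..t} (\<lambda>w. A *v Y w)" and ?J = "integral {s..t} F"
      have "Y t = Y s + ?I + ?J"
        using Y[of t] Y[of s] diff[OF int_AY st(1-3)] diff[OF int_F st(1-3)] st by simp
      also have "\<dots> = (Y s + ?h *\<^sub>R (A *v Y s)) + ((?I - ?h *\<^sub>R (A *v Y s)) + ?J)" by simp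
      finally have "N (Y t) \<le> N (Y s + ?h *\<^sub>R (A *v Y s)) + N ((?I - ?h *\<^sub>R (A *v Y s)) + ?J)"
        using N_add by metis
      also have "\<dots> \<le> (1 - r * ?h) * ?n + b * (norm (?I - ?h *\<^sub>R (A *v Y s)) + norm ?J)"
        using contract[of ?h "Y s"] st b(2)[of "(?I - ?h *\<^sub>R (A *v Y s)) + ?J"]
          mult_left_mono[OF norm_triangle_ineq[of "?I - ?h *\<^sub>R (A *v Y s)" ?J], of b] b(1) by linarith
      also have "\<dots> \<le> (1 - r * ?h) * ?n + b * (?h * (\<eta> * \<alpha>) + ?g * (c * ?n + \<eta>))"
      proof -
        have iA: "(\<lambda>w. A *v Y w - A *v Y s) integrable_on {s..t}"
          using sub[OF int_AY st(1,3)] by (intro integrable_diff) auto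
        have "?I - ?h *\<^sub>R (A *v Y s) = integral {s..t} (\<lambda>w. A *v Y w - A *v Y s)"
          using sub[OF int_AY st(1,3)] st
          by (subst Henstock_Kurzweil_Integration.integral_diff) auto
        also have "norm \<dots> \<le> integral {s..t} (\<lambda>w. \<eta> * \<alpha>)"
        proof (rule integral_norm_bound_integral[OF iA])
          fix w assume w: "w \<in> {s..t}"
          have "norm (A *v Y w - A *v Y s) \<le> norm (Y w - Y s) * \<alpha>"
            using \<alpha>(2)[of "Y w - Y s"] by (simp add: matrix_vector_mult_diff_distrib)
          also have "\<dots> \<le> \<eta> * \<alpha>" using near[OF w] \<alpha>(1) by (intro mult_right_mono) auto
          finally show "norm (A *v Y w - A *v Y s) \<le> \<eta> * \<alpha>" .
        qed auto
        also have "\<dots> = ?h * (\<eta> * \<alpha>)" using st by simp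
        finally have 1: "norm (?I - ?h *\<^sub>R (A *v Y s)) \<le> ?h * (\<eta> * \<alpha>)" .
        have ig: "\<gamma> integrable_on {s..t}" by (rule sub[OF int_g st(1,3)])
        have "norm ?J \<le> integral {s..t} (\<lambda>w. \<gamma> w * (c * ?n + \<eta>))"
        proof (rule integral_norm_bound_integral[OF sub[OF int_F st(1,3)]])
          show "(\<lambda>w. \<gamma> w * (c * ?n + \<eta>)) integrable_on {s..t}"
            using ig by (rule integrable_on_mult_left)
          fix w assume w: "w \<in> {s..t}"
          have "norm (Y w) \<le> norm (Y s) + norm (Y w - Y s)"
            using norm_triangle_ineq[of "Y s" "Y w - Y s"] by simp
          then have "norm (Y w) \<le> c * ?n + \<eta>" using near[OF w] c(2)[of "Y s"] by linarith
          then show "norm (F w) \<le> \<gamma> w * (c * ?n + \<eta>)"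
            using F_le[of w] w st g_nonneg[of w] by (auto intro: order_trans mult_left_mono)
        qed
        also have "\<dots> = ?g * (c * ?n + \<eta>)"
          using diff[OF int_g st(1-3)] by (simp add: G_def integral_mult_left)
        finally show ?thesis using 1 b by (intro add_left_mono mult_left_mono add_mono) auto
      qed
      also have "\<dots> = ?n * (1 + (b * c * ?g - r * ?h)) + b * \<eta> * (m t - m s)"
        by (simp add: m_def algebra_simps)
      \<comment> \<open>both the decay and the perturbation are turned into the weight of \<open>\<phi>\<close> by \<open>1 + y \<le> exp y\<close>\<close>
      also have "\<dots> \<le> ?n * exp (b * c * ?g - r * ?h) + b * \<eta> * (m t - m s)"
        by (intro add_right_mono mult_left_mono exp_ge_add_one_self N_nonneg)
      finally have "\<phi> t \<le> (?n * exp (b * c * ?g - r * ?h) + b * \<eta> * (m t - m s)) * exp (r * t - b * c * G t)"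
        unfolding \<phi>_def by (intro mult_right_mono) auto
      also have "\<dots> = \<phi> s + b * \<eta> * (m t - m s) * exp (r * t - b * c * G t)"
        by (simp add: \<phi>_def distrib_right exp_add[symmetric] mult.assoc) (simp add: algebra_simps)
      also have "\<dots> \<le> \<phi> s + b * \<eta> * (m t - m s) * exp (r * T)"
      proof -
        have "0 \<le> b * c * G t" using b c G_mono[of 0 t] G0 st by simp
        moreover have "r * t \<le> r * T" using r st by simp
        moreover have "0 \<le> m t - m s"
          using G_mono[OF st(1-3)] mult_left_mono[OF st(2), of \<alpha>] \<alpha>(1)
          unfolding m_def by linarith
        ultimately show ?thesis using b \<eta> by (intro add_left_mono mult_left_mono) auto
      qed
      finally show ?thesis by (simp add: K_def mult_ac)
    qed
    \<comment> \<open>Adding up the local bounds over a subdivision of \<open>{0..T}\<close>, as a bisection argument.\<close>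
    define P where "P s t \<longleftrightarrow> (0 \<le> s \<and> t \<le> T \<longrightarrow> \<phi> t - \<phi> s \<le> \<eta> * K * (m t - m s))" for s t
    have "P 0 T"
    proof (rule Bolzano[OF T])
      show "P s w" if "P s t" "P t w" "s \<le> t" "t \<le> w" for s t w
        using that by (auto simp: P_def algebra_simps)
      show "\<exists>d>0. \<forall>s t. s \<le> x \<and> x \<le> t \<and> t - s < d \<longrightarrow> P s t" for x
        using \<open>0 < \<delta>\<close> \<open>0 < \<delta>'\<close> local_bound
        by (intro exI[of _ "min \<delta> \<delta>'"]) (auto simp: P_def)
    qed
    then have "\<phi> T - \<phi> 0 \<le> \<eta> * K * (m T - m 0)" by (simp add: P_def)
    then show ?thesis by simp
  qed
  have "\<phi> T - \<phi> 0 \<le> 0"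
  proof (rule ccontr)
    assume neg: "\<not> ?thesis"
    define D where "D = \<bar>K * (m T - m 0)\<bar> + 1"
    have D: "0 < D" "K * (m T - m 0) < D" by (auto simp: D_def)
    define \<eta> where "\<eta> = (\<phi> T - \<phi> 0) / D"
    have \<eta>: "0 < \<eta>" using neg D by (simp add: \<eta>_def)
    have "\<eta> * K * (m T - m 0) < \<eta> * D"
      using \<eta> D by (simp add: mult.assoc)
    then show False using step[OF \<eta>] D by (simp add: \<eta>_def)
  qed
  moreover have "\<phi> 0 = N x0" using Y[of 0] T G0 by (simp add: \<phi>_def)
  ultimately have "N (Y T) * exp (r * T - b * c * G T) \<le> N x0" by (simp add: \<phi>_def)
  then have "N (Y T) * exp (r * T - b * c * G T) * exp (b * c * G T - r * T) \<le> N x0 * exp (b * c * G T - r * T)"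
    by (intro mult_right_mono) auto
  then show ?thesis by (simp add: G_def mult.assoc exp_add[symmetric])
qed

section \<open>Time-change along a path of the subordinator\<close>

text \<open>One sample path \<open>u\<close> of the subordinator, with its first-passage time \<open>e\<close>. The path \<open>u\<close> may jump, and
  across a jump \<open>e\<close> is constant.\<close>

locale subordinator_path =
  fixes u e :: "real \<Rightarrow> real"
  assumes u_zero: "u 0 = 0"
    and u_strict_mono: "strict_mono_on {0..} u"
    and u_right_cont: "\<And>t. 0 \<le> t \<Longrightarrow> (u \<longlongrightarrow> u t) (at_right t)"
    and u_at_top: "filterlim u at_top at_top"
    and e_eq: "\<And>t. e t = Inf {s. 0 < s \<and> t < u s}"
begin

lemma u_less: "0 \<le> s \<Longrightarrow> s < t \<Longrightarrow> u s < u t"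
  using u_strict_mono by (auto simp: strict_mono_on_def)

lemma u_le: "0 \<le> s \<Longrightarrow> s \<le> t \<Longrightarrow> u s \<le> u t"
  using u_less[of s t] by (cases "s = t") auto

lemma passage_set_nonempty: "{s. 0 < s \<and> t < u s} \<noteq> {}"
proof -
  have "eventually (\<lambda>s. t < u s \<and> 0 < s) at_top"
    using u_at_top eventually_gt_at_top[of 0]
    by (auto simp: filterlim_at_top_dense eventually_conj_iff)
  then show ?thesis by (force simp: eventually_at_top_linorder)
qed

lemma e_nonneg: "0 \<le> e t"
  unfolding e_eq using passage_set_nonempty[of t] by (intro cInf_greatest) auto

text \<open>The Galois-type relation between \<open>u\<close> and \<open>e\<close>, from which the other properties of \<open>e\<close> are read off.
  Right-continuity of \<open>u\<close> enters in the direction from right to left.\<close>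

lemma less_e_iff:
  assumes "0 \<le> a"
  shows "a < e t \<longleftrightarrow> u a < t"
proof
  assume *: "a < e t"
  show "u a < t"
  proof (rule ccontr)
    assume "\<not> u a < t"
    obtain s where s: "a < s" "s < e t" using * dense by blast
    have "t < u s" using u_less[of a s] s \<open>0 \<le> a\<close> \<open>\<not> u a < t\<close> by linarith
    then have "e t \<le> s" unfolding e_eq using s \<open>0 \<le> a\<close>
      by (intro cInf_lower) (auto intro!: bdd_belowI[of _ 0])
    then show False using s by simp
  qed
next
  assume "u a < t"
  then have "eventually (\<lambda>s. u s < t) (at_right a)"
    using u_right_cont[OF assms] order_tendstoD(2) by blast
  then obtain b where b: "a < b" "\<And>s. a < s \<Longrightarrow> s < b \<Longrightarrow> u s < t"
    unfolding eventually_at_right_field by auto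
  obtain s where s: "a < s" "s < b" using b(1) dense by blast
  have "s \<le> e t" unfolding e_eq
  proof (rule cInf_greatest[OF passage_set_nonempty])
    fix r assume "r \<in> {s. 0 < s \<and> t < u s}"
    then show "s \<le> r" using b(2)[OF s] u_le[of r s] by force
  qed
  then show "a < e t" using s by simp
qed

lemma e_mono: "s \<le> t \<Longrightarrow> e s \<le> e t"
  using less_e_iff[OF e_nonneg, of t t] less_e_iff[OF e_nonneg, of t s] by force

lemma e_u: assumes "0 \<le> a" shows "e (u a) = a"
proof (rule antisym)
  show "e (u a) \<le> a" using less_e_iff[OF assms, of "u a"] by auto
  show "a \<le> e (u a)" using less_e_iff[OF e_nonneg, of "u a" "u a"] u_less[OF e_nonneg, of "u a" a] by force
qed

lemma le_u_e: "t \<le> u (e t)"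
  using less_e_iff[OF e_nonneg, of t t] by auto

lemma e_right_cont: "continuous (at_right t) e"
proof -
  have "(e \<longlongrightarrow> e t) (at_right t)"
  proof (rule order_tendstoI)
    fix a assume "a < e t"
    then show "eventually (\<lambda>s. a < e s) (at_right t)"
      unfolding eventually_at_right_field using e_mono by (intro exI[of _ "t+1"]) (auto intro: less_le_trans)
  next
    fix a assume "e t < a"
    then obtain b where b: "e t < b" "b < a" using dense by blast
    have "t < u b" using le_u_e[of t] u_less[OF e_nonneg b(1)] by linarith
    moreover have "e s < a" if "s < u b" for s
      using less_e_iff[of b s] b e_nonneg[of t] that by force
    ultimately show "eventually (\<lambda>s. e s < a) (at_right t)"
      unfolding eventually_at_right_field by blast
  qed
  then show ?thesis by (simp add: continuous_within)
qed

lemma e_at_top: "filterlim e at_top at_top"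
  unfolding filterlim_at_top_gt[of _ _ 0]
proof safe
  fix a :: real assume "0 < a"
  then show "eventually (\<lambda>t. a \<le> e t) at_top"
    by (intro eventually_mono[OF eventually_gt_at_top[of "u a"]]) (simp add: less_e_iff less_imp_le)
qed

lemma emeasure_e_Ioc: "a \<le> b \<Longrightarrow> emeasure (interval_measure e) {a<..b} = ennreal (e b - e a)"
  by (rule emeasure_interval_measure_Ioc) (auto intro: e_mono e_right_cont)

lemma u_measurable: "u \<in> borel_measurable (restrict_space lborel {0<..T})"
proof -
  have "mono_on {0<..T} u" by (auto simp: mono_on_def intro: u_le)
  from borel_measurable_mono_on_fnc[OF this] show ?thesis
    by (simp cong: measurable_cong_sets sets_restrict_space_cong)
qed

text \<open>The change of variables \<open>r = u s\<close>: it turns \<open>d e(r)\<close> into \<open>d s\<close>. For \<open>0 \<le> x \<le> u T\<close> both measures give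
  \<open>{x<..}\<close> the mass \<open>T - e x\<close>, because \<open>x < u s\<close> amounts to \<open>e x < s\<close> except possibly at the single
  point \<open>s = e x\<close>. Pushing Lebesgue measure forward along \<open>u\<close>, rather than the Stieltjes measure along
  \<open>e\<close>, makes integrands that live on the \<open>r\<close>-axis substitute directly.\<close>

lemma distr_u:
  assumes "0 \<le> T"
  shows "distr (restrict_space lborel {0<..T}) borel u
       = density (interval_measure e) (indicator {0<..u T})" (is "?D = ?R")
proof (rule measure_eqI_lessThan)
  have T: "e (u T) = T" "0 \<le> u T" using e_u[OF assms] u_le[of 0 T] assms u_zero by auto
  have L: "emeasure ?D {x<..} = ennreal (T - e (max 0 x))" if "x \<le> u T" for x
  proof -
    have "emeasure ?D {x<..} = emeasure (restrict_space lborel {0<..T}) (u -` {x<..} \<inter> {0<..T})"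
      using u_measurable by (subst emeasure_distr) (auto simp: space_restrict_space)
    also have "\<dots> = emeasure lborel (u -` {x<..} \<inter> {0<..T})"
      by (intro emeasure_restrict_space) auto
    also have "\<dots> = emeasure lborel {e (max 0 x)<..T}"
    proof (rule emeasure_eq_AE)
      show "AE s in lborel. (s \<in> u -` {x<..} \<inter> {0<..T}) = (s \<in> {e (max 0 x)<..T})"
        using AE_lborel_singleton[of "e (max 0 x)"]
      proof eventually_elim
        case (elim s)
        show ?case
        proof (cases "0 < s")
          case True
          have "u 0 < u s" using u_less[of 0 s] True by simp
          then have pos: "0 < u s" using u_zero by simp
          have "x < u s \<longleftrightarrow> max 0 x < u s" using pos by auto
          also have "\<dots> \<longleftrightarrow> e (max 0 x) < s"
          proof
            assume "max 0 x < u s"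
            then have "\<not> s < e (max 0 x)" using less_e_iff[of s "max 0 x"] True by auto
            then show "e (max 0 x) < s" using elim by auto
          next
            assume "e (max 0 x) < s"
            then show "max 0 x < u s"
              using le_u_e[of "max 0 x"] u_less[OF e_nonneg, of "max 0 x" s] by linarith
          qed
          finally show ?thesis using True by auto
        next
          case False then show ?thesis using e_nonneg[of "max 0 x"] by auto
        qed
      qed
      have "u -` {x<..} \<inter> {0<..T} \<in> sets (restrict_space lborel {0<..T})"
        using measurable_sets[OF u_measurable, of "{x<..}"] by (simp add: space_restrict_space)
      then show "u -` {x<..} \<inter> {0<..T} \<in> sets lborel"
        by (subst (asm) sets_restrict_space_iff) auto
    qed simp
    also have "\<dots> = ennreal (T - e (max 0 x))"
      using e_mono[of "max 0 x" "u T"] T that by simp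
    finally show ?thesis .
  qed
  have R: "emeasure ?R {x<..} = ennreal (T - e (max 0 x))" if "x \<le> u T" for x
  proof -
    have "emeasure ?R {x<..} = emeasure (interval_measure e) ({0<..u T} \<inter> {x<..})"
      by (subst emeasure_density)
         (auto simp flip: nn_integral_indicator indicator_inter_arith intro!: nn_integral_cong)
    also have "{0<..u T} \<inter> {x<..} = {max 0 x<..u T}" by auto
    also have "emeasure (interval_measure e) \<dots> = ennreal (T - e (max 0 x))"
      using T that by (subst emeasure_e_Ioc) auto
    finally show ?thesis .
  qed
  have L0: "emeasure ?D {x<..} \<le> emeasure ?D {u T<..}" if "u T \<le> x" for x
    using that by (intro emeasure_mono) auto
  have R0: "emeasure ?R {x<..} \<le> emeasure ?R {u T<..}" if "u T \<le> x" for x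
    using that by (intro emeasure_mono) auto
  have z: "emeasure ?D {u T<..} = 0" "emeasure ?R {u T<..} = 0"
    using L[of "u T"] R[of "u T"] T by (auto simp: max_def)
  fix x
  show "emeasure ?D {x<..} = emeasure ?R {x<..}"
    using L R L0 R0 z by (cases "x \<le> u T") auto
  show "emeasure ?D {x<..} < \<infinity>"
    using L L0 z by (cases "x \<le> u T") (auto simp: less_top[symmetric])
qed auto

lemma time_change:
  fixes h :: "real \<Rightarrow> 'b::euclidean_space"
  assumes "0 \<le> T" and int: "set_integrable (interval_measure e) {0<..u T} h"
  shows "set_integrable lborel {0<..T} (\<lambda>s. h (u s))"
    and "(LINT r:{0<..u T}|interval_measure e. h r) = (LINT s:{0<..T}|lborel. h (u s))"
proof -
  \<comment> \<open>Only the restricted integrand is known to be measurable, so \<open>h\<close> is truncated first.\<close>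
  define k where "k = (\<lambda>r. indicator {0<..u T} r *\<^sub>R h r)"
  have k: "integrable (interval_measure e) k"
    using int by (simp add: k_def set_integrable_def)
  then have km [measurable]: "k \<in> borel_measurable borel"
    using borel_measurable_integrable[OF k] by simp
  have kk: "indicator {0<..u T} r *\<^sub>R k r = k r" for r by (auto simp: k_def indicator_def)
  have ku: "indicator {0<..T} s *\<^sub>R k (u s) = indicator {0<..T} s *\<^sub>R h (u s)" for s
    using u_less[of 0 s] u_le[of s T] u_zero by (auto simp: k_def indicator_def)
  have ind: "indicator {0<..u T} = (\<lambda>r. ennreal (indicator {0<..u T} r))"
    by (auto simp: indicator_def)
  have "integrable (density (interval_measure e) (indicator {0<..u T})) k"
    unfolding ind using k by (subst integrable_density) (auto simp: kk)
  then have "integrable (restrict_space lborel {0<..T}) (\<lambda>s. k (u s))"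
    unfolding distr_u[OF assms(1), symmetric] using u_measurable by (subst (asm) integrable_distr_eq) auto
  then show "set_integrable lborel {0<..T} (\<lambda>s. h (u s))"
    by (subst (asm) integrable_restrict_space) (auto simp: set_integrable_def ku)
  have "(LINT r:{0<..u T}|interval_measure e. h r) = (LINT r|density (interval_measure e) (indicator {0<..u T}). k r)"
    unfolding ind by (subst integral_density) (auto simp: kk, simp add: k_def set_lebesgue_integral_def)
  also have "\<dots> = (LINT s|restrict_space lborel {0<..T}. k (u s))"
    unfolding distr_u[OF assms(1), symmetric] using u_measurable by (subst integral_distr) auto
  also have "\<dots> = (LINT s:{0<..T}|lborel. h (u s))"
    by (subst integral_restrict_space) (auto simp: set_lebesgue_integral_def ku)
  finally show "(LINT r:{0<..u T}|interval_measure e. h r) = (LINT s:{0<..T}|lborel. h (u s))" .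
qed

text \<open>The level set of \<open>e\<close> containing \<open>t\<close> reaches up to \<open>u (e t)\<close>, and the Stieltjes measure does not charge it.
  So a solution at time \<open>t\<close> depends on \<open>e t\<close> only.\<close>

lemma set_integral_constant_on_plateau:
  fixes h :: "real \<Rightarrow> 'b::euclidean_space"
  assumes "0 \<le> t" and "set_integrable (interval_measure e) {0<..u (e t)} h"
  shows "(LINT r:{0<..t}|interval_measure e. h r) = (LINT r:{0<..u (e t)}|interval_measure e. h r)"
proof -
  have "emeasure (interval_measure e) {t<..u (e t)} = 0"
    using emeasure_e_Ioc[OF le_u_e] e_u[OF e_nonneg] by simp
  then have "AE r in interval_measure e. r \<notin> {t<..u (e t)}"
    by (intro AE_not_in) (auto simp: null_sets_def)
  then have *: "AE r in interval_measure e. indicator {0<..t} r *\<^sub>R h r = indicator {0<..u (e t)} r *\<^sub>R h r"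
    by eventually_elim (use le_u_e[of t] in \<open>auto simp: indicator_def\<close>)
  have k: "(\<lambda>r. indicator {0<..u (e t)} r *\<^sub>R h r) \<in> borel_measurable (interval_measure e)"
    using assms(2) by (auto simp: set_integrable_def)
  have "(\<lambda>r. indicator {0<..t} r *\<^sub>R h r) = (\<lambda>r. indicator {0<..t} r *\<^sub>R (indicator {0<..u (e t)} r *\<^sub>R h r))"
    using le_u_e[of t] by (intro ext) (simp add: indicator_def)
  also have "\<dots> \<in> borel_measurable (interval_measure e)"
    by (rule borel_measurable_scaleR[OF _ k]) auto
  finally have "(\<lambda>r. indicator {0<..t} r *\<^sub>R h r) \<in> borel_measurable (interval_measure e)" .
  then show ?thesis unfolding set_lebesgue_integral_def using k * by (intro integral_cong_AE)
qed

end

section \<open>Stability of the time-changed system\<close>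

context subordinator_path
begin

text \<open>In the operational time \<open>s = e t\<close> the process \<open>Y s = x (u s)\<close> solves the ordinary integral equation
  \<open>Y' = A Y + f(s, Y)\<close>, and \<open>x t = Y (e t)\<close>. The decay of \<open>Y\<close> in \<open>s\<close> becomes decay of \<open>x\<close> in \<open>e t\<close>, with a constant
  that involves the path neither through \<open>u\<close> nor through \<open>e\<close>.\<close>

lemma solution_bound:
  fixes x :: "real \<Rightarrow> real ^ 'n" and A :: "real ^ 'n ^ 'n" and g :: "real \<Rightarrow> real ^ 'n"
  assumes N_add: "\<And>x y. N (x + y) \<le> N x + N y" and N_nonneg: "\<And>x. 0 \<le> N x"
    and b: "0 < b" "\<And>x. N x \<le> b * norm x" and c: "0 < c" "\<And>x. norm x \<le> c * N x"
    and r: "0 < r" "0 < \<delta>"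
    and contract: "\<And>h x. 0 \<le> h \<Longrightarrow> h \<le> \<delta> \<Longrightarrow> N (x + h *\<^sub>R (A *v x)) \<le> (1 - r * h) * N x"
    and int_A: "\<And>t. 0 \<le> t \<Longrightarrow> set_integrable (interval_measure e) {0<..t} (\<lambda>s. A *v x s)"
    and int_f: "\<And>t. 0 \<le> t \<Longrightarrow> set_integrable (interval_measure e) {0<..t} (\<lambda>s. f (e s) (x s))"
    and x: "\<And>t. 0 \<le> t \<Longrightarrow> x t = x0 + (LINT s:{0<..t}|interval_measure e. A *v x s)
                                   + (LINT s:{0<..t}|interval_measure e. f (e s) (x s))"
    and f_le: "\<And>t. 0 \<le> t \<Longrightarrow> norm (f (e t) (x t)) \<le> norm (g (e t)) * norm (x t)"
    and g: "set_integrable lebesgue {0..} (\<lambda>s. norm (g s))"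
    and t: "0 \<le> t"
  shows "norm (x t) \<le> c * b * exp (b * c * integral {0..} (\<lambda>s. norm (g s))) * norm x0 * exp (- r * e t)"
proof -
  define Y where "Y s = x (u s)" for s
  define F where "F s = f (e (u s)) (x (u s))" for s
  have u_nonneg: "0 \<le> u s" if "0 \<le> s" for s using u_le[of 0 s] that u_zero by simp
  have half_open: "h integrable_on {0..s} \<and> (LINT q:{0<..s}|lborel. h q) = integral {0..s} h"
    if h: "set_integrable lborel {0<..s} h" and "0 \<le> s" for h :: "real \<Rightarrow> real ^ 'n" and s
  proof -
    have "{0..s} = insert 0 {0<..s}" using that(2) by auto
    moreover have "integral (insert 0 {0<..s}) h = integral {0<..s} h"
      by (rule integral_spike_set) (auto intro: negligible_subset[of "{0}"])
    ultimately show ?thesis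
      using set_borel_integral_eq_integral[OF h] by (simp add: integrable_on_insert_iff)
  qed
  have A: "(\<lambda>q. A *v Y q) integrable_on {0..s}"
          "(LINT q:{0<..u s}|interval_measure e. A *v x q) = integral {0..s} (\<lambda>q. A *v Y q)" if "0 \<le> s" for s
    using time_change[OF that int_A[OF u_nonneg[OF that]]] half_open[OF _ that] by (auto simp: Y_def)
  have F: "F integrable_on {0..s}"
          "(LINT q:{0<..u s}|interval_measure e. f (e q) (x q)) = integral {0..s} F" if "0 \<le> s" for s
    using time_change[OF that int_f[OF u_nonneg[OF that]]] half_open[OF _ that] by (auto simp: F_def[abs_def])
  have g1: "(\<lambda>s. norm (g s)) integrable_on {0..}" using set_lebesgue_integral_eq_integral(1)[OF g] .
  then have g2: "(\<lambda>s. norm (g s)) integrable_on {0..s}" for s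
    by (rule integrable_on_subinterval) auto
  have "N (Y (e t)) \<le> N x0 * exp (b * c * integral {0..e t} (\<lambda>s. norm (g s)) - r * e t)"
  proof (rule perturbed_linear_decay[where A = A and F = F and \<delta> = \<delta>])
    show "norm (F s) \<le> norm (g s) * norm (Y s)" if "0 \<le> s" for s
      using f_le[OF u_nonneg[OF that]] e_u[OF that] by (simp add: F_def Y_def)
    show "Y s = x0 + integral {0..s} (\<lambda>s. A *v Y s) + integral {0..s} F" if "0 \<le> s" for s
      using x[OF u_nonneg[OF that]] A[OF that] F[OF that] by (simp add: Y_def)
  qed (use assms A F g2 e_nonneg in auto)
  also have "\<dots> \<le> (b * norm x0) * exp (b * c * integral {0..} (\<lambda>s. norm (g s)) - r * e t)"
  proof (intro mult_mono b(2))
    have "integral {0..e t} (\<lambda>s. norm (g s)) \<le> integral {0..} (\<lambda>s. norm (g s))"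
      by (rule integral_subset_le) (use g1 g2 in auto)
    then show "exp (b * c * integral {0..e t} (\<lambda>s. norm (g s)) - r * e t)
        \<le> exp (b * c * integral {0..} (\<lambda>s. norm (g s)) - r * e t)" using b c by simp
  qed (use b in auto)
  finally have *: "N (Y (e t)) \<le> \<dots>" .
  have "x t = Y (e t)" unfolding Y_def
    using x[OF t] x[OF u_nonneg[OF e_nonneg]]
      set_integral_constant_on_plateau[OF t int_A[OF u_nonneg[OF e_nonneg]]]
      set_integral_constant_on_plateau[OF t int_f[OF u_nonneg[OF e_nonneg]]] by simp
  then have "norm (x t) \<le> c * N (Y (e t))" using c(2) by simp
  also have "\<dots> \<le> c * ((b * norm x0) * exp (b * c * integral {0..} (\<lambda>s. norm (g s)) - r * e t))"
    using * c by (intro mult_left_mono) auto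
  finally show ?thesis by (simp add: exp_diff exp_minus field_simps)
qed

end

lemma stable_subordinator_path:
  assumes "stable_subordinator M \<beta> U" "\<omega> \<in> space M"
  shows "subordinator_path (\<lambda>t. U t \<omega>) (\<lambda>t. inverse_subordinator U t \<omega>)"
  using assms by unfold_locales (auto simp: stable_subordinator_def levy_process_def inverse_subordinator_def)

lemma inverse_subordinator_measurable:
  assumes U: "stable_subordinator M \<beta> U"
  shows "inverse_subordinator U t \<in> borel_measurable M"
proof (rule borel_measurableI_greater)
  fix a :: real
  have Um: "U a \<in> borel_measurable M" if "0 \<le> a"
    using U that by (auto simp: stable_subordinator_def levy_process_def)
  show "{\<omega> \<in> space M. a < inverse_subordinator U t \<omega>} \<in> sets M"
  proof (cases "0 \<le> a")
    case True
    have "{\<omega> \<in> space M. a < inverse_subordinator U t \<omega>} = {\<omega> \<in> space M. U a \<omega> < t}"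
      using subordinator_path.less_e_iff[OF stable_subordinator_path[OF U] True] by auto
    also have "\<dots> \<in> sets M" using Um[OF True] by measurable
    finally show ?thesis .
  next
    case False
    then have "{\<omega> \<in> space M. a < inverse_subordinator U t \<omega>} = space M"
      using subordinator_path.e_nonneg[OF stable_subordinator_path[OF U]] by (auto intro: less_le_trans[of a 0])
    then show ?thesis by simp
  qed
qed

text \<open>Every path of the inverse subordinator tends to infinity and the integrand is at most \<open>1\<close>, so
  dominated convergence applies.\<close>

lemma inverse_subordinator_laplace_tendsto_zero:
  assumes "prob_space M" and U: "stable_subordinator M \<beta> U" and q: "0 < q"
  shows "((\<lambda>t. \<integral>\<omega>. exp (- q * inverse_subordinator U t \<omega>) \<partial>M) \<longlongrightarrow> 0) at_top"
proof -
  interpret prob_space M by fact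
  note [measurable] = inverse_subordinator_measurable[OF U]
  have "((\<lambda>t. \<integral>\<omega>. exp (- q * inverse_subordinator U t \<omega>) \<partial>M) \<longlongrightarrow> (\<integral>\<omega>. 0 \<partial>M)) at_top"
  proof (rule integral_dominated_convergence_at_top[where w = "\<lambda>_. 1"])
    show "AE \<omega> in M. ((\<lambda>t. exp (- q * inverse_subordinator U t \<omega>)) \<longlongrightarrow> 0) at_top"
    proof (rule AE_I2)
      fix \<omega> assume "\<omega> \<in> space M"
      then have lim: "filterlim (\<lambda>t. inverse_subordinator U t \<omega>) at_top at_top"
        using subordinator_path.e_at_top[OF stable_subordinator_path[OF U]] by blast
      have "filterlim (\<lambda>t. - q * inverse_subordinator U t \<omega>) at_bot at_top"
        using filterlim_tendsto_neg_mult_at_bot[OF tendsto_const _ lim, of "- q"] q by simp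
      then show "((\<lambda>t. exp (- q * inverse_subordinator U t \<omega>)) \<longlongrightarrow> 0) at_top"
        by (rule filterlim_compose[OF exp_at_bot])
    qed
    show "\<forall>\<^sub>F t in at_top. AE \<omega> in M. norm (exp (- q * inverse_subordinator U t \<omega>)) \<le> 1"
      using q subordinator_path.e_nonneg[OF stable_subordinator_path[OF U]] by (auto intro!: always_eventually AE_I2)
  qed auto
  then show ?thesis by simp
qed

theorem theorem3p1:
  fixes M :: "'a measure"
    and \<beta> :: real
    and U E :: "real \<Rightarrow> 'a \<Rightarrow> real"
    and A :: "real ^ 'n ^ 'n"
    and f :: "real \<Rightarrow> real ^ 'n \<Rightarrow> real ^ 'n"
    and g :: "real \<Rightarrow> real ^ 'n"
    and X :: "real ^ 'n \<Rightarrow> real \<Rightarrow> 'a \<Rightarrow> real ^ 'n"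
  assumes "prob_space M"
    and "0 < \<beta>" "\<beta> < 1"
    and "stable_subordinator M \<beta> U"
    and "E = inverse_subordinator U"
    and "\<forall>\<mu>\<in>matrix_spectrum A. Re \<mu> < 0"
    and "\<forall>\<omega>\<in>space M. \<forall>t\<ge>0. f (E t \<omega>) 0 = 0"
    and "\<forall>x0. time_changed_solution M E A f x0 (X x0)"
    and "\<forall>x0. \<forall>\<omega>\<in>space M. \<forall>t\<ge>0.
           norm (f (E t \<omega>) (X x0 t \<omega>)) \<le> norm (g (E t \<omega>)) * norm (X x0 t \<omega>)"
    and "set_integrable lebesgue {0..} (\<lambda>s. norm (g s))"
  shows "exp_sample_path_stable M X \<and> (\<forall>p\<ge>1. moment_asymp_stable M p X)"
proof -
  interpret prob_space M by fact
  note U = \<open>stable_subordinator M \<beta> U\<close> and E = \<open>E = inverse_subordinator U\<close>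
  note path = stable_subordinator_path[OF U, folded E]
  have Em [measurable]: "E t \<in> borel_measurable M" for t
    unfolding E by (rule inverse_subordinator_measurable[OF U])
  have E_nonneg: "0 \<le> E t \<omega>" if "\<omega> \<in> space M" for t \<omega>
    using subordinator_path.e_nonneg[OF path[OF that]] .
  obtain N b c r \<delta> where N: "\<And>x y :: real ^ 'n. N (x + y) \<le> N x + N y" "\<And>x. 0 \<le> N x"
    "0 < b" "\<And>x. N x \<le> b * norm x" "0 < c" "\<And>x. norm x \<le> c * N x" and r:
    "0 < r" "0 < \<delta>" "\<And>h x. 0 \<le> h \<Longrightarrow> h \<le> \<delta> \<Longrightarrow> N (x + h *\<^sub>R (A *v x)) \<le> (1 - r * h) * N x"
    using adapted_norm[of A] assms(6) by blast
  define K where "K = c * b * exp (b * c * integral {0..} (\<lambda>s. norm (g s)))"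
  have K: "0 < K" using N by (simp add: K_def)
  have bound: "norm (X x0 t \<omega>) \<le> K * norm x0 * exp (- r * E t \<omega>)"
    if \<omega>: "\<omega> \<in> space M" and t: "0 \<le> t" for x0 t \<omega>
    unfolding K_def
  proof (rule subordinator_path.solution_bound[OF path[OF \<omega>] N r _ _ _ _ assms(10) t, where f = f])
    note sol = assms(8)[rule_format, of x0, unfolded time_changed_solution_def, THEN conjunct2, rule_format, OF \<omega>]
    fix s :: real assume s: "0 \<le> s"
    from sol[OF s] show "set_integrable (interval_measure (\<lambda>t. E t \<omega>)) {0<..s} (\<lambda>s. A *v X x0 s \<omega>)"
      "set_integrable (interval_measure (\<lambda>t. E t \<omega>)) {0<..s} (\<lambda>s. f (E s \<omega>) (X x0 s \<omega>))"
      "X x0 s \<omega> = x0 + (LINT s:{0<..s}|interval_measure (\<lambda>t. E t \<omega>). A *v X x0 s \<omega>)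
                   + (LINT s:{0<..s}|interval_measure (\<lambda>t. E t \<omega>). f (E s \<omega>) (X x0 s \<omega>))"
      by auto
    show "norm (f (E s \<omega>) (X x0 s \<omega>)) \<le> norm (g (E s \<omega>)) * norm (X x0 s \<omega>)"
      using assms(9) \<omega> s by blast
  qed
  have "exp_sample_path_stable M X"
    unfolding exp_sample_path_stable_def
  proof (rule exI[of _ r], rule conjI[OF r(1)], rule exI[of _ K], rule conjI[OF K], rule ballI)
    fix \<omega> assume \<omega>: "\<omega> \<in> space M"
    show "\<exists>\<nu>. (\<forall>t\<ge>0. 0 \<le> \<nu> t) \<and> filterlim \<nu> at_top at_top \<and>
        (\<forall>t\<ge>0. \<forall>x0. norm (X x0 t \<omega>) \<le> K * norm x0 * exp (- r * \<nu> t))"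
      using bound[OF \<omega>] E_nonneg[OF \<omega>] subordinator_path.e_at_top[OF path[OF \<omega>]]
      by (intro exI[of _ "\<lambda>t. E t \<omega>"]) blast
  qed
  moreover have "moment_asymp_stable M p X" if p: "1 \<le> p" for p
  proof -
    \<comment> \<open>The \<open>p\<close>th power of the pathwise bound leaves the Laplace transform of \<open>E t\<close> at \<open>p * r\<close>.\<close>
    define \<nu> where "\<nu> t = (\<integral>\<omega>. exp (- (p * r) * E t \<omega>) \<partial>M)" for t
    have "(\<nu> \<longlongrightarrow> 0) at_top" unfolding \<nu>_def E
      using inverse_subordinator_laplace_tendsto_zero[OF assms(1) U, of "p * r"] p r by simp
    moreover have "0 \<le> \<nu> t" for t by (simp add: \<nu>_def)
    moreover have "(\<integral>\<^sup>+\<omega>. ennreal (norm (X x0 t \<omega>) powr p) \<partial>M) \<le> ennreal (K powr p * norm x0 powr p * \<nu> t)"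
      if t: "0 \<le> t" for x0 t
    proof -
      have "(\<integral>\<^sup>+\<omega>. ennreal (norm (X x0 t \<omega>) powr p) \<partial>M)
          \<le> (\<integral>\<^sup>+\<omega>. ennreal (K powr p * norm x0 powr p * exp (- (p * r) * E t \<omega>)) \<partial>M)"
      proof (intro nn_integral_mono ennreal_leI)
        fix \<omega> assume \<omega>: "\<omega> \<in> space M"
        have "norm (X x0 t \<omega>) powr p \<le> (K * norm x0 * exp (- r * E t \<omega>)) powr p"
          using bound[OF \<omega> t] p by (intro powr_mono2) auto
        also have "\<dots> = K powr p * norm x0 powr p * exp (- (p * r) * E t \<omega>)"
          using K by (simp add: powr_mult) (simp add: powr_def mult_ac)
        finally show "norm (X x0 t \<omega>) powr p \<le> K powr p * norm x0 powr p * exp (- (p * r) * E t \<omega>)" .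
      qed
      also have "\<dots> = ennreal (\<integral>\<omega>. K powr p * norm x0 powr p * exp (- (p * r) * E t \<omega>) \<partial>M)"
      proof (intro nn_integral_eq_integral integrable_mult_right)
        show "integrable M (\<lambda>\<omega>. exp (- (p * r) * E t \<omega>))"
          using p r E_nonneg by (intro integrable_const_bound[where B = 1]) auto
      qed auto
      also have "\<dots> = ennreal (K powr p * norm x0 powr p * \<nu> t)" by (simp add: \<nu>_def)
      finally show ?thesis .
    qed
    ultimately show ?thesis unfolding moment_asymp_stable_def using K
      by (intro exI[of _ \<nu>] exI[of _ "K powr p"]) auto
  qed
  ultimately show ?thesis by blast
qed

end
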